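(* Let $m, k$ be positive integers with $m > k$ and $\gcd(m,k)=1$. For each real $c>0$ let $p_c(z) = z^m + c\,(z^k + \overline{z}^k) - 1$ for $z\in\mathbb{C}$, and let $Z(c)$ be the number of zeros of $p_c$ in $\mathbb{C}$. Then, as $c$ increases over $(0,\infty)$, $Z(c)$ increases monotonically (i.e. is non-decreasing) from a minimum of $m$ to a maximum of $m+N$ (both values being attained), where $N$ is determined as follows: \begin{itemize} \item if $m\equiv 0 \pmod 4$, then $N=m$; \item if $m\equiv 1 \pmod 4$ and $k$ is odd, then $N=m-1$; \item if $m\equiv 1 \pmod 4$ and $k$ is even, then $N=m+1$; \item if $m\equiv 2 \pmod 4$, then $N=m-2$; \item if $m\equiv 3 \pmod 4$ and $k$ is odd, then $N=m+1$; \item if $m\equiv 3 \pmod 4$ and $k$ is even, then $N=m-1$. \end{itemize}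
   Context: Zeros are counted as distinct points of $\mathbb{C}$ (without multiplicity). $\overline{z}$ denotes the complex conjugate of $z$. *)

theory Defs
  imports Complex_Main
begin

definition p :: "nat \<Rightarrow> nat \<Rightarrow> real \<Rightarrow> complex \<Rightarrow> complex" where
  "p m k c z = z ^ m + complex_of_real c * (z ^ k + cnj z ^ k) - 1"

definition zeros :: "nat \<Rightarrow> nat \<Rightarrow> real \<Rightarrow> complex set" where
  "zeros m k c = {z. p m k c z = 0}"

definition Z :: "nat \<Rightarrow> nat \<Rightarrow> real \<Rightarrow> nat" where
  "Z m k c = card (zeros m k c)"

text \<open>The truncated subtractions are harmless, since only \<open>m > k \<ge> 1\<close>,
  hence \<open>m \<ge> 2\<close>, is of interest. The last branch is \<open>m mod 4 = 3\<close>.\<close>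

definition N :: "nat \<Rightarrow> nat \<Rightarrow> nat" where
  "N m k =
    (if m mod 4 = 0 then m
     else if m mod 4 = 1 then (if odd k then m - 1 else m + 1)
     else if m mod 4 = 2 then m - 2
     else (if odd k then m + 1 else m - 1))"

end

theory Submission
  imports Defs
begin

text \<open>
  The equation \<open>p m k c z = 0\<close> says \<open>z ^ m = 1 - 2 * c * Re (z ^ k)\<close>, so \<open>z ^ m\<close> is real and, as
  \<open>z \<noteq> 0\<close>, the zero \<open>z\<close> lies on one of the \<open>2 * m\<close> rays of argument \<open>pi * j / m\<close> with \<open>j < 2 * m\<close>.
  On the ray number \<open>j\<close> the equation becomes a real trinomial equation for the modulus,
  \<open>(-1) ^ j * r ^ m + b * r ^ k = 1\<close> with \<open>b = 2 * c * cos (pi * j * k / m)\<close>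
  (\<open>Z_eq_sum_over_rays\<close>), and everything reduces to counting its positive solutions.

  For even \<open>j\<close> there is exactly one solution whatever \<open>b\<close> is (\<open>card_even_ray\<close>); these \<open>m\<close> rays
  give the constant contribution \<open>m\<close>. For odd \<open>j\<close> the equation is \<open>r ^ m + 1 = b * r ^ k\<close>, that is,
  \<open>b = r ^ (m - k) + r powr (- k)\<close>. The right-hand side falls from infinity to a minimum and rises
  to infinity again, so as \<open>b\<close> increases the number of solutions passes from 0 through 1 to 2: it is
  0 for \<open>b \<le> 1\<close>, 2 for \<open>b > 2\<close>, and monotone in \<open>b\<close> (\<open>card_tri_roots_mono\<close>). Hence \<open>Z\<close> is
  monotone, equals \<open>m\<close> for \<open>c = 1 / 2\<close>, and for large \<open>c\<close> equals \<open>m\<close> plus twice the number of odd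
  \<open>j < 2 * m\<close> with \<open>cos (pi * j * k / m) > 0\<close>.

  It remains to count these \<open>j\<close>. Since \<open>k\<close> and \<open>m\<close> are coprime, multiplication by \<open>k\<close> maps the odd
  residues modulo \<open>2 * m\<close> bijectively onto the residues that have the parity of \<open>k\<close>
  (\<open>bij_mult_odd_residues\<close>), and the cosine is positive exactly at the residues in the outer
  quarters of the interval from 0 to \<open>2 * m\<close>. Counting those of the right parity gives \<open>N m k / 2\<close>.
\<close>

section \<open>Positive solutions of the two real trinomial equations\<close>

definition tri_roots :: "nat \<Rightarrow> nat \<Rightarrow> real \<Rightarrow> real set" where
  "tri_roots m k b = {r. 0 < r \<and> r ^ m + 1 = b * r ^ k}"

text \<open>The leading power wins from \<open>1 + \<bar>b\<bar>\<close> on; this supplies the right end point whenever the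
  intermediate value theorem is applied.\<close>

lemma leading_power_dominates:
  fixes b M :: real
  assumes "k < m" "1 + \<bar>b\<bar> \<le> M"
  shows "1 \<le> M ^ m + b * M ^ k"
proof -
  have M: "1 \<le> M" using assms(2) by linarith
  have "M ^ 1 \<le> M ^ (m - k)"
    using M assms(1) by (intro power_increasing) auto
  then have "1 \<le> M ^ (m - k) + b" using assms(2) by (simp add: abs_if split: if_splits)
  moreover have "1 \<le> M ^ k" using M by simp
  ultimately have "1 * 1 \<le> M ^ k * (M ^ (m - k) + b)"
    by (intro mult_mono) auto
  also have "\<dots> = M ^ m + b * M ^ k"
    using assms(1) by (simp add: algebra_simps flip: power_add)
  finally show ?thesis by simp
qed

text \<open>After division by \<open>r ^ k\<close> the equation reads \<open>r ^ (m - k) + b = 1 / r ^ k\<close>, with the left side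
  increasing and the right side decreasing.\<close>

lemma unique_root_even_ray:
  fixes b :: real
  assumes "0 < k" "k < m"
  shows "\<exists>!r. 0 < r \<and> r ^ m + b * r ^ k = 1"
proof -
  have uniq: False
    if "0 < x" "x < y" "x ^ m + b * x ^ k = 1" "y ^ m + b * y ^ k = 1" for x y :: real
  proof -
    have split: "r ^ m + b * r ^ k = r ^ k * (r ^ (m - k) + b)" for r :: real
      using assms(2) by (simp add: algebra_simps flip: power_add)
    have xk: "x ^ k < y ^ k" and xmk: "x ^ (m - k) < y ^ (m - k)"
      using that assms by (auto intro!: power_strict_mono)
    have 1: "x ^ k * (x ^ (m - k) + b) = 1" "y ^ k * (y ^ (m - k) + b) = 1"
      using that split by simp_all
    have "0 < x ^ k" using that by simp
    then have "0 < x ^ (m - k) + b"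
      using 1(1) by (metis zero_less_mult_pos zero_less_one)
    then have "x ^ k * (x ^ (m - k) + b) < y ^ k * (y ^ (m - k) + b)"
      using xk xmk \<open>0 < x ^ k\<close> by (intro mult_strict_mono) auto
    then show False using 1 by simp
  qed
  define M where "M = 1 + \<bar>b\<bar>"
  have "\<exists>r\<ge>0. r \<le> M \<and> r ^ m + b * r ^ k = 1"
  proof (rule IVT)
    show "0 ^ m + b * 0 ^ k \<le> 1" using assms by (simp add: power_0_left)
    show "1 \<le> M ^ m + b * M ^ k"
      using assms by (intro leading_power_dominates) (auto simp: M_def)
    show "0 \<le> M" by (simp add: M_def)
  qed (auto intro!: continuous_intros)
  then obtain r where r: "0 \<le> r" "r ^ m + b * r ^ k = 1" by blast
  moreover have "r \<noteq> 0" using r assms by (auto simp: power_0_left)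
  ultimately have ex: "0 < r \<and> r ^ m + b * r ^ k = 1" by simp
  then show ?thesis
  proof (rule ex1I)
    fix s assume "0 < s \<and> s ^ m + b * s ^ k = 1"
    then show "s = r" using uniq[of s r] uniq[of r s] ex by (cases s r rule: linorder_cases) auto
  qed
qed

text \<open>By Rolle, three solutions would give two positive zeros of the derivative
  \<open>m * r ^ (m - 1) - b * k * r ^ (k - 1)\<close>, but there \<open>r ^ (m - k)\<close> has the prescribed value \<open>b * k / m\<close>.\<close>

lemma no_three_tri_roots:
  assumes "0 < k" "k < m" "x \<in> tri_roots m k b" "y \<in> tri_roots m k b" "z \<in> tri_roots m k b"
    "x < y" "y < z"
  shows False
proof -
  define h where "h r = r ^ m + 1 - b * r ^ k" for r :: real
  define h' where "h' r = real m * r ^ (m - 1) - b * (real k * r ^ (k - 1))" for r :: real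
  have deriv: "(h has_real_derivative h' r) (at r)" for r
    unfolding h_def h'_def by (auto intro!: derivative_eq_intros)
  have cont: "continuous_on A h" for A
    unfolding h_def by (intro continuous_intros)
  have zero: "h x = 0" "h y = 0" "h z = 0" "0 < x"
    using assms by (auto simp: tri_roots_def h_def)
  have crit: "\<exists>s>u. s < v \<and> h' s = 0" if uv: "u < v" "h u = h v" for u v
  proof -
    have "\<exists>s>u. s < v \<and> (\<lambda>w. h' s * w) = (\<lambda>w. 0)"
      by (rule Rolle_deriv[where f = h and f' = "\<lambda>r w. h' r * w", OF uv cont])
        (use deriv in \<open>simp add: has_field_derivative_def\<close>)
    then show ?thesis by (metis mult.right_neutral)
  qed
  obtain s where s: "x < s" "s < y" "h' s = 0" using crit[of x y] assms zero by auto
  obtain t where t: "y < t" "t < z" "h' t = 0" using crit[of y z] assms zero by auto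
  have val: "real m * r ^ (m - k) = b * real k" if "h' r = 0" "0 < r" for r
  proof -
    have "r ^ (m - 1) = r ^ (k - 1) * r ^ (m - k)"
      using assms by (simp flip: power_add)
    then have "r ^ (k - 1) * (real m * r ^ (m - k)) = r ^ (k - 1) * (b * real k)"
      using that(1) by (simp add: h'_def algebra_simps)
    then show ?thesis using that(2) by simp
  qed
  have "real m * s ^ (m - k) = real m * t ^ (m - k)"
    using val[of s] val[of t] s t zero by simp
  then have "s ^ (m - k) = t ^ (m - k)" using assms by simp
  moreover have "s ^ (m - k) < t ^ (m - k)"
    using s t zero assms by (intro power_strict_mono) auto
  ultimately show False by simp
qed

lemma tri_roots_finite_card_le_2:
  assumes "0 < k" "k < m"
  shows "finite (tri_roots m k b) \<and> card (tri_roots m k b) \<le> 2"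
proof (rule ccontr)
  assume *: "\<not> ?thesis"
  have "\<exists>T \<subseteq> tri_roots m k b. finite T \<and> card T = 3"
  proof (cases "finite (tri_roots m k b)")
    case True
    with * have "3 \<le> card (tri_roots m k b)" by simp
    then show ?thesis by (meson obtain_subset_with_card_n)
  next
    case False
    then show ?thesis by (meson infinite_arbitrarily_large)
  qed
  then obtain T where T: "T \<subseteq> tri_roots m k b" "finite T" "card T = 3" by blast
  define xs where "xs = sorted_list_of_set T"
  have xs: "sorted_wrt (<) xs" "length xs = 3" "set xs = T"
    using T by (simp_all add: xs_def)
  have "xs ! 0 < xs ! 1" "xs ! 1 < xs ! 2"
    using xs by (auto simp: sorted_wrt_iff_nth_less)
  moreover have "xs ! i \<in> tri_roots m k b" if "i < 3" for i
    using xs T that by (metis nth_mem subsetD)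
  ultimately show False
    using no_three_tri_roots[OF assms, of "xs ! 0" b "xs ! 1" "xs ! 2"] by simp
qed

text \<open>One root lies on either side of a point where \<open>r ^ m + 1 - b * r ^ k\<close> is negative, since this
  function is positive at 0 and for large \<open>r\<close>.\<close>

lemma card_tri_roots_eq_2:
  assumes "0 < k" "k < m" "0 < s" "s ^ m + 1 < b * s ^ k"
  shows "card (tri_roots m k b) = 2"
proof -
  define h where "h r = r ^ m + 1 - b * r ^ k" for r :: real
  define M where "M = 1 + \<bar>b\<bar> + s"
  have cont: "continuous_on A h" for A
    unfolding h_def by (intro continuous_intros)
  have hs: "h s < 0" using assms by (simp add: h_def)
  have "h 0 = 1" using assms by (simp add: h_def power_0_left)
  then have "\<exists>x\<ge>0. x \<le> s \<and> h x = 0"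
    using hs assms by (intro IVT2' cont) auto
  then obtain x where x: "0 \<le> x" "x \<le> s" "h x = 0" by blast
  have "1 \<le> M ^ m + (- b) * M ^ k"
    using assms by (intro leading_power_dominates) (auto simp: M_def)
  then have "0 \<le> h M" by (simp add: h_def)
  then have "\<exists>y\<ge>s. y \<le> M \<and> h y = 0"
    using hs by (intro IVT' cont) (auto simp: M_def)
  then obtain y where y: "s \<le> y" "y \<le> M" "h y = 0" by blast
  have "x \<noteq> s" "y \<noteq> s" "x \<noteq> 0" using hs x y \<open>h 0 = 1\<close> by auto
  then have "{x, y} \<subseteq> tri_roots m k b" "x \<noteq> y"
    using x y assms by (auto simp: tri_roots_def h_def)
  then have "2 \<le> card (tri_roots m k b)"
    using card_mono[of "tri_roots m k b" "{x, y}"] tri_roots_finite_card_le_2[OF assms(1,2)]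
    by simp
  then show ?thesis using tri_roots_finite_card_le_2[OF assms(1,2), of b] by simp
qed

text \<open>A solution for \<open>b\<close> is a point where \<open>r ^ m + 1 - b' * r ^ k\<close> is negative as soon as
  \<open>b < b'\<close>.\<close>

lemma card_tri_roots_mono:
  assumes "0 < k" "k < m" "b \<le> b'"
  shows "card (tri_roots m k b) \<le> card (tri_roots m k b')"
proof (cases "b = b' \<or> tri_roots m k b = {}")
  case False
  then obtain s where s: "0 < s" "s ^ m + 1 = b * s ^ k" by (auto simp: tri_roots_def)
  have "b * s ^ k < b' * s ^ k" using False s assms by simp
  then have "card (tri_roots m k b') = 2"
    using s assms by (intro card_tri_roots_eq_2[of k m s]) auto
  then show ?thesis using tri_roots_finite_card_le_2[OF assms(1,2), of b] by simp
qed auto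

lemma tri_roots_empty:
  assumes "k < m" "b \<le> 1"
  shows "tri_roots m k b = {}"
proof -
  have False if "0 < r" "r ^ m + 1 = b * r ^ k" for r :: real
  proof -
    have "b * r ^ k \<le> r ^ k" using that assms by simp
    moreover have "r ^ k < r ^ m + 1"
    proof (cases "1 \<le> r")
      case True
      then have "r ^ k \<le> r ^ m" using assms by (intro power_increasing) auto
      then show ?thesis by simp
    next
      case False
      then have "r ^ k \<le> 1" using that by (intro power_le_one) auto
      moreover have "0 < r ^ m" using that by simp
      ultimately show ?thesis by linarith
    qed
    ultimately show False using that by simp
  qed
  then show ?thesis by (auto simp: tri_roots_def)
qed

section \<open>Decomposition of the zero set along rays\<close>

definition ray_coeff :: "nat \<Rightarrow> nat \<Rightarrow> nat \<Rightarrow> real" where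
  "ray_coeff m k j = cos (pi * real (j * k) / real m)"

definition ray_roots :: "nat \<Rightarrow> nat \<Rightarrow> real \<Rightarrow> nat \<Rightarrow> real set" where
  "ray_roots m k c j = {r. 0 < r \<and> (-1) ^ j * r ^ m + 2 * c * ray_coeff m k j * r ^ k = 1}"

definition ray_point :: "nat \<Rightarrow> nat \<times> real \<Rightarrow> complex" where
  "ray_point m = (\<lambda>(j, r). complex_of_real r * cis (pi * real j / real m))"

lemma p_polar:
  "p m k c (complex_of_real r * cis t) =
    Complex (r ^ m * cos (real m * t) + 2 * c * cos (real k * t) * r ^ k - 1) (r ^ m * sin (real m * t))"
  by (simp add: p_def complex_eq_iff power_mult_distrib DeMoivre cis_cnj flip: of_real_power)

lemma p_ray_point_eq_0_iff:
  assumes "0 < m"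
  shows "p m k c (ray_point m (j, r)) = 0 \<longleftrightarrow>
    (-1) ^ j * r ^ m + 2 * c * ray_coeff m k j * r ^ k = 1"
proof -
  have eqs: "real m * (pi * real j / real m) = real j * pi"
    "real k * (pi * real j / real m) = pi * real (j * k) / real m"
    using assms by (simp_all add: field_simps)
  show ?thesis
    unfolding ray_point_def prod.case p_polar eqs
    by (auto simp: ray_coeff_def complex_eq_iff mult.commute)
qed

lemma even_ray_roots:
  assumes "0 < k" "k < m" "even j"
  shows "\<exists>r. ray_roots m k c j = {r}"
proof -
  have "\<exists>!r. r \<in> ray_roots m k c j"
    using unique_root_even_ray[OF assms(1,2), of "2 * c * ray_coeff m k j"] assms(3)
    by (simp add: ray_roots_def)
  then show ?thesis by blast
qed

lemma card_even_ray:
  assumes "0 < k" "k < m" "even j"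
  shows "card (ray_roots m k c j) = 1"
  using even_ray_roots[OF assms, of c] by auto

lemma odd_ray_roots:
  "odd j \<Longrightarrow> ray_roots m k c j = tri_roots m k (2 * c * ray_coeff m k j)"
  by (auto simp: ray_roots_def tri_roots_def)

lemma finite_ray_roots:
  assumes "0 < k" "k < m"
  shows "finite (ray_roots m k c j)"
  using even_ray_roots[OF assms, of j c] tri_roots_finite_card_le_2[OF assms] odd_ray_roots
  by (cases "even j") auto

lemma inj_on_ray_point:
  assumes "0 < m"
  shows "inj_on (ray_point m) ({..<2 * m} \<times> {0<..})"
proof (rule inj_onI)
  fix x y assume xy: "x \<in> {..<2 * m} \<times> {0<..}" "y \<in> {..<2 * m} \<times> {0<..}"
    and "ray_point m x = ray_point m y"
  moreover obtain i r j s where ijrs: "x = (i, r)" "y = (j, s)" by (metis surj_pair)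
  ultimately have ij: "i < 2 * m" "j < 2 * m" and pos: "r > 0" "s > 0"
    and eq: "ray_point m (i, r) = ray_point m (j, s)" by auto
  have "norm (ray_point m (i, r)) = norm (ray_point m (j, s))" using eq by simp
  then have rs: "r = s" using pos by (simp add: ray_point_def norm_mult)
  then have "cis (pi * real i / real m) = cis (pi * real j / real m)"
    using eq pos by (simp add: ray_point_def)
  then obtain n :: int where n: "pi * real i / real m = pi * real j / real m + 2 * pi * n"
    using sin_cos_eq_iff by (metis cis.sel)
  then have "pi * real i = pi * (real j + 2 * n * m)"
    using assms by (simp add: field_simps)
  then have "real_of_int (int i) = real_of_int (int j + 2 * n * int m)"
    by simp
  then have "int i = int j + 2 * n * int m" by (simp only: of_int_eq_iff)
  then have "int i mod int (2 * m) = int j mod int (2 * m)" by (simp add: mod_eq_dvd_iff)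
  then have "i = j" using ij by (metis mod_less of_nat_eq_iff of_nat_mod)
  then show "x = y" using rs ijrs by simp
qed

text \<open>The imaginary part of the equation for \<open>z = r * cis t\<close> is \<open>r ^ m * sin (m * t) = 0\<close>, which
  forces \<open>t\<close> to be a multiple of \<open>pi / m\<close>.\<close>

lemma zeros_eq_ray_points:
  assumes "0 < k" "k < m"
  shows "zeros m k c = ray_point m ` (SIGMA j:{..<2 * m}. ray_roots m k c j)"
proof (intro equalityI subsetI)
  fix z assume "z \<in> zeros m k c"
  then have z: "p m k c z = 0" by (simp add: zeros_def)
  then have "z \<noteq> 0" using assms by (auto simp: p_def power_0_left)
  define r where "r = norm z"
  have r: "0 < r" using \<open>z \<noteq> 0\<close> by (simp add: r_def)
  have "(Re z / r)\<^sup>2 + (Im z / r)\<^sup>2 = ((Re z)\<^sup>2 + (Im z)\<^sup>2) / r\<^sup>2"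
    by (simp add: power_divide add_divide_distrib)
  also have "(Re z)\<^sup>2 + (Im z)\<^sup>2 = r\<^sup>2" by (simp add: r_def cmod_power2)
  finally have "(Re z / r)\<^sup>2 + (Im z / r)\<^sup>2 = 1" using r by simp
  then obtain t where t: "0 \<le> t" "t < 2 * pi" "Re z / r = cos t" "Im z / r = sin t"
    by (rule sincos_total_2pi)
  have zt: "z = complex_of_real r * cis t"
    using t r by (simp add: complex_eq_iff field_simps)
  then have "sin (real m * t) = 0"
    using z r unfolding zt p_polar by (simp add: complex_eq_iff)
  then obtain i :: int where i: "real m * t = real_of_int i * pi" by (auto simp: sin_zero_iff_int2)
  have "0 \<le> real_of_int i * pi" using t by (simp flip: i)
  then have "0 \<le> i" using pi_gt_zero by (simp add: zero_le_mult_iff del: pi_gt_zero)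
  moreover have "real_of_int i * pi < real_of_int (2 * int m) * pi"
    using t assms by (simp flip: i)
  then have "i < 2 * int m" using pi_gt_zero by (simp only: mult_less_cancel_right_pos of_int_less_iff)
  moreover define j where "j = nat i"
  ultimately have j: "j < 2 * m" "real_of_int i = real j" by auto
  have "t = pi * real j / real m" using i j assms by (simp add: field_simps)
  then have zj: "z = ray_point m (j, r)" by (simp add: ray_point_def zt)
  then have "r \<in> ray_roots m k c j"
    using z r assms p_ray_point_eq_0_iff[of m k c j r] by (simp add: ray_roots_def)
  then show "z \<in> ray_point m ` (SIGMA j:{..<2 * m}. ray_roots m k c j)"
    using j zj by blast
qed (use assms p_ray_point_eq_0_iff in \<open>auto simp: zeros_def ray_roots_def\<close>)

lemma finite_zeros:
  assumes "0 < k" "k < m"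
  shows "finite (zeros m k c)"
  using finite_ray_roots[OF assms] by (auto simp: zeros_eq_ray_points[OF assms])

lemma card_odd_residues:
  "card {j. j < 2 * m \<and> odd j} = (m::nat)" "card {j. j < 2 * m \<and> even j} = (m::nat)"
proof -
  have "{j. j < 2 * m \<and> odd j} = (\<lambda>i. 2 * i + 1) ` {..<m}"
    by (auto elim!: oddE)
  then show "card {j. j < 2 * m \<and> odd j} = m"
    by (simp add: card_image inj_on_def)
  have "{j. j < 2 * m \<and> even j} = (\<lambda>i. 2 * i) ` {..<m}"
    by (auto elim!: evenE)
  then show "card {j. j < 2 * m \<and> even j} = m"
    by (simp add: card_image inj_on_def)
qed

lemma Z_eq_sum_over_rays:
  assumes "0 < k" "k < m"
  shows "Z m k c = m + (\<Sum>j | j < 2 * m \<and> odd j. card (tri_roots m k (2 * c * ray_coeff m k j)))"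
proof -
  have "inj_on (ray_point m) (SIGMA j:{..<2 * m}. ray_roots m k c j)"
    using assms by (intro inj_on_subset[OF inj_on_ray_point]) (auto simp: ray_roots_def)
  then have "Z m k c = card (SIGMA j:{..<2 * m}. ray_roots m k c j)"
    by (simp add: Z_def zeros_eq_ray_points[OF assms] card_image)
  also have "\<dots> = (\<Sum>j<2 * m. card (ray_roots m k c j))"
    using finite_ray_roots[OF assms] by (intro card_SigmaI) auto
  also have "{..<2 * m} = {j. j < 2 * m \<and> even j} \<union> {j. j < 2 * m \<and> odd j}" by auto
  also have "(\<Sum>j\<in>\<dots>. card (ray_roots m k c j)) =
      (\<Sum>j | j < 2 * m \<and> even j. card (ray_roots m k c j)) +
      (\<Sum>j | j < 2 * m \<and> odd j. card (ray_roots m k c j))"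
    by (rule sum.union_disjoint) auto
  also have "(\<Sum>j | j < 2 * m \<and> even j. card (ray_roots m k c j)) = m"
    using card_even_ray[OF assms] card_odd_residues(2)[of m] by simp
  finally show ?thesis by (simp add: odd_ray_roots)
qed

section \<open>Counting the odd rays with positive coefficient\<close>

definition pos_odd_rays :: "nat \<Rightarrow> nat \<Rightarrow> nat set" where
  "pos_odd_rays m k = {j. j < 2 * m \<and> odd j \<and> 0 < ray_coeff m k j}"

text \<open>Two odd residues differ by an even number \<open>2 * d\<close>, so \<open>2 * m\<close> dividing \<open>2 * d * k\<close> implies that
  \<open>m\<close> divides \<open>d\<close>. This argument is insensitive to the parity of \<open>k\<close>, and source and
  target both have \<open>m\<close> elements.\<close>

lemma bij_mult_odd_residues:
  fixes m k :: nat
  assumes "0 < m" "coprime m k"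
  shows "bij_betw (\<lambda>j. j * k mod (2 * m)) {j. j < 2 * m \<and> odd j} {t. t < 2 * m \<and> even t = even k}"
    (is "bij_betw ?f ?A ?B")
proof -
  have inj: "inj_on ?f ?A"
  proof (rule inj_onI, clarify)
    fix i j assume ij: "i < 2 * m" "odd i" "j < 2 * m" "odd j"
      and eq: "i * k mod (2 * m) = j * k mod (2 * m)"
    obtain a b where ab: "i = 2 * a + 1" "j = 2 * b + 1" using ij by (metis oddE)
    define d where "d = int a - int b"
    have "int (i * k) mod int (2 * m) = int (j * k) mod int (2 * m)"
      using eq by (metis of_nat_mod)
    then have "int (2 * m) dvd int (i * k) - int (j * k)" by (simp only: mod_eq_dvd_iff)
    also have "int (i * k) - int (j * k) = 2 * (d * int k)"
      by (simp add: ab d_def algebra_simps)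
    finally have "int m dvd d * int k" by simp
    then have "int m dvd d" using assms by (simp add: coprime_dvd_mult_left_iff)
    moreover have "\<bar>d\<bar> < int m" using ij ab by (auto simp: d_def)
    ultimately have "d = 0" using zdvd_not_zless[of "\<bar>d\<bar>" "int m"] by (cases "d = 0") auto
    then show "i = j" by (simp add: d_def ab)
  qed
  moreover have "?f ` ?A \<subseteq> ?B"
    using assms by (auto simp: dvd_mod_iff)
  moreover have "card ?A = card ?B"
    using card_odd_residues[of m] by (cases "even k") simp_all
  ultimately have "?f ` ?A = ?B"
    by (intro card_subset_eq) (auto simp: card_image)
  then show ?thesis using inj by (simp add: bij_betw_def)
qed

lemma ray_coeff_mod:
  assumes "0 < m"
  shows "ray_coeff m k j = cos (pi * real (j * k mod (2 * m)) / real m)"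
proof -
  define q t where "q = j * k div (2 * m)" and "t = j * k mod (2 * m)"
  have "j * k = q * (2 * m) + t" by (simp only: q_def t_def div_mult_mod_eq)
  then have "real (j * k) = real q * (2 * real m) + real t"
    by (metis of_nat_add of_nat_mult of_nat_numeral)
  then have "pi * real (j * k) / real m = pi * real t / real m + 2 * real q * pi"
    using assms by (simp add: field_simps)
  then have "ray_coeff m k j = cos (pi * real t / real m + 2 * real q * pi)"
    unfolding ray_coeff_def by (rule arg_cong)
  also have "\<dots> = cos (pi * real t / real m)"
    by (simp only: cos_add cos_2npi sin_2npi)
  finally show ?thesis by (simp add: t_def)
qed

lemma cos_pos_iff_outer_quarter:
  fixes t m :: nat
  assumes "t < 2 * m"
  shows "0 < cos (pi * real t / real m) \<longleftrightarrow> 2 * t < m \<or> 3 * m < 2 * t"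
proof -
  define x where "x = pi * real t / real m"
  have m: "0 < real m" using assms by simp
  have x: "0 \<le> x" "x < 2 * pi"
    using assms m by (auto simp: x_def field_simps)
  have lo: "2 * t < m \<longleftrightarrow> x < pi / 2"
  proof -
    have "x < pi / 2 \<longleftrightarrow> pi * (2 * real t) < pi * real m"
      using m by (simp add: x_def field_simps)
    also have "\<dots> \<longleftrightarrow> real (2 * t) < real m" by (simp del: of_nat_mult add: of_nat_mult)
    finally show ?thesis by (simp only: of_nat_less_iff)
  qed
  have hi: "3 * m < 2 * t \<longleftrightarrow> 3 * pi / 2 < x"
  proof -
    have "3 * pi / 2 < x \<longleftrightarrow> pi * (3 * real m) < pi * (2 * real t)"
      using m by (simp add: x_def field_simps)
    also have "\<dots> \<longleftrightarrow> real (3 * m) < real (2 * t)" by simp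
    finally show ?thesis by (simp only: of_nat_less_iff)
  qed
  consider "x < pi / 2" | "pi / 2 \<le> x" "x \<le> 3 * pi / 2" | "3 * pi / 2 < x" by linarith
  then have "0 < cos x \<longleftrightarrow> x < pi / 2 \<or> 3 * pi / 2 < x"
  proof cases
    case 1
    then show ?thesis using x by (simp add: cos_gt_zero_pi)
  next
    case 2
    have "0 \<le> cos (x - pi)" using 2 by (intro cos_ge_zero) auto
    then show ?thesis using 2 by simp
  next
    case 3
    have "0 < cos (x - 2 * pi)" using 3 x by (intro cos_gt_zero_pi) auto
    then show ?thesis using 3 by (simp add: cos_diff)
  qed
  then show ?thesis by (simp add: x_def lo hi flip: x_def)
qed

lemma div_4_affine:
  fixes q :: nat
  shows "(s * (4 * q + r) + a) div 4 = s * q + (s * r + a) div 4"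
proof -
  have "s * (4 * q + r) + a = (s * r + a) + (s * q) * 4" by (simp add: algebra_simps)
  then show ?thesis by (simp only: div_mult_self1)
qed

lemma two_quarter_sums_eq_N:
  assumes "0 < m"
  shows "odd m \<Longrightarrow> even k \<Longrightarrow> 2 * ((m + 3) div 4 + (m - (3 * m div 4 + 1))) = N m k"
    and "odd k \<Longrightarrow> 2 * ((m + 1) div 4 + (m - (3 * m + 2) div 4)) = N m k"
proof -
  define q r where "q = m div 4" and "r = m mod 4"
  have m: "m = 4 * q + r" by (simp add: q_def r_def)
  have "r < 4" by (simp add: r_def)
  then consider "r = 0" | "r = 1" | "r = 2" | "r = 3" by linarith
  note r_cases = this
  have N: "N m k = (if r = 0 then m else if r = 1 then (if odd k then m - 1 else m + 1)
     else if r = 2 then m - 2 else (if odd k then m + 1 else m - 1))"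
    by (simp add: N_def r_def)
  show "2 * ((m + 3) div 4 + (m - (3 * m div 4 + 1))) = N m k" if "odd m" "even k"
    using div_4_affine[of 1 q r 3] div_4_affine[of 3 q r 0] that assms unfolding N
    by (cases rule: r_cases) (simp_all add: m)
  show "2 * ((m + 1) div 4 + (m - (3 * m + 2) div 4)) = N m k" if "odd k"
    using div_4_affine[of 1 q r 1] div_4_affine[of 3 q r 2] that assms unfolding N
    by (cases rule: r_cases) (simp_all add: m)
qed

text \<open>For even \<open>k\<close> the elements are \<open>t = 2 * s\<close> with \<open>4 * s < m\<close> or \<open>4 * s > 3 * m\<close>; for odd \<open>k\<close> they are
  \<open>t = 2 * s + 1\<close> with \<open>4 * s + 2 < m\<close> or \<open>4 * s + 2 > 3 * m\<close>. Either way \<open>s\<close> runs over an initial and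
  a final segment of \<open>{..<m}\<close>. For even \<open>k\<close> and even \<open>m\<close> the count would differ from \<open>N\<close>;
  coprimality rules that case out.\<close>

lemma card_outer_quarters:
  fixes m :: nat and k :: nat
  assumes "0 < m" "even k \<Longrightarrow> odd m"
  shows "2 * card {t. t < 2 * m \<and> even t = even k \<and> (2 * t < m \<or> 3 * m < 2 * t)} = N m k"
    (is "2 * card ?C = _")
proof (cases "even k")
  case True
  have "?C = (\<lambda>s. 2 * s) ` ({..<(m + 3) div 4} \<union> {3 * m div 4 + 1..<m})"
    using True by (auto simp: image_iff elim!: evenE)
  then have "card ?C = card ({..<(m + 3) div 4} \<union> {3 * m div 4 + 1..<m})"
    by (simp add: card_image inj_on_def)
  also have "\<dots> = (m + 3) div 4 + (m - (3 * m div 4 + 1))"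
    by (subst card_Un_disjoint) auto
  finally show ?thesis using True assms two_quarter_sums_eq_N(1)[of m k] by simp
next
  case False
  have "?C = (\<lambda>s. 2 * s + 1) ` ({..<(m + 1) div 4} \<union> {(3 * m + 2) div 4..<m})"
    using False by (auto simp: image_iff elim!: oddE)
  then have "card ?C = card ({..<(m + 1) div 4} \<union> {(3 * m + 2) div 4..<m})"
    by (simp add: card_image inj_on_def)
  also have "\<dots> = (m + 1) div 4 + (m - (3 * m + 2) div 4)"
    by (subst card_Un_disjoint) auto
  finally show ?thesis using False assms two_quarter_sums_eq_N(2)[of m k] by simp
qed

lemma card_pos_odd_rays:
  assumes "0 < m" "coprime m k"
  shows "2 * card (pos_odd_rays m k) = N m k"
proof -
  let ?f = "\<lambda>j. j * k mod (2 * m)"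
  let ?C = "{t. t < 2 * m \<and> even t = even k \<and> (2 * t < m \<or> 3 * m < 2 * t)}"
  have iff: "0 < ray_coeff m k j \<longleftrightarrow> 2 * ?f j < m \<or> 3 * m < 2 * ?f j" for j
    using assms by (subst ray_coeff_mod) (auto simp: cos_pos_iff_outer_quarter)
  note bij = bij_mult_odd_residues[OF assms]
  have "?f ` pos_odd_rays m k = ?C"
  proof (intro equalityI subsetI)
    fix t assume t: "t \<in> ?C"
    then have "t \<in> ?f ` {j. j < 2 * m \<and> odd j}"
      using bij by (simp add: bij_betw_def)
    then show "t \<in> ?f ` pos_odd_rays m k"
      using t iff by (auto simp: pos_odd_rays_def)
  next
    fix t assume "t \<in> ?f ` pos_odd_rays m k"
    then obtain j where j: "j \<in> pos_odd_rays m k" "t = ?f j" by blast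
    then have "t \<in> {t. t < 2 * m \<and> even t = even k}"
      using bij by (auto simp: bij_betw_def pos_odd_rays_def)
    then show "t \<in> ?C" using j iff by (auto simp: pos_odd_rays_def)
  qed
  moreover have "inj_on ?f (pos_odd_rays m k)"
    by (rule inj_on_subset[OF bij_betw_imp_inj_on[OF bij]]) (auto simp: pos_odd_rays_def)
  ultimately have "card (pos_odd_rays m k) = card ?C" by (metis card_image)
  moreover have "odd m" if "even k" using that assms(2) by (metis coprime_common_divisor odd_one)
  ultimately show ?thesis using card_outer_quarters[of m k] assms by simp
qed

section \<open>The number of zeros as a function of the parameter\<close>

lemma Z_eq_sum_over_pos_odd_rays:
  assumes "0 < k" "k < m" "0 < c"
  shows "Z m k c = m + (\<Sum>j\<in>pos_odd_rays m k. card (tri_roots m k (2 * c * ray_coeff m k j)))"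
proof -
  have "tri_roots m k (2 * c * ray_coeff m k j) = {}" if "ray_coeff m k j \<le> 0" for j
  proof -
    have "2 * c * ray_coeff m k j \<le> 0" using that assms by (simp add: mult_nonneg_nonpos)
    then show ?thesis using assms by (intro tri_roots_empty) auto
  qed
  then have "card (tri_roots m k (2 * c * ray_coeff m k j)) = 0" if "\<not> 0 < ray_coeff m k j" for j
    using that by simp
  then have "(\<Sum>j | j < 2 * m \<and> odd j. card (tri_roots m k (2 * c * ray_coeff m k j))) =
      (\<Sum>j\<in>pos_odd_rays m k. card (tri_roots m k (2 * c * ray_coeff m k j)))"
    by (intro sum.mono_neutral_right) (fastforce simp: pos_odd_rays_def)+
  then show ?thesis using Z_eq_sum_over_rays[OF assms(1,2), of c] by simp
qed

theorem theorem1: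
  fixes m k :: nat
  assumes "0 < k" and "k < m" and "coprime m k"
  shows "(\<forall>c>0. finite (zeros m k c)) \<and>
    mono_on {0<..} (Z m k) \<and>
    (\<forall>c>0. m \<le> Z m k c \<and> Z m k c \<le> m + N m k) \<and>
    (\<exists>c>0. Z m k c = m) \<and>
    (\<exists>c>0. Z m k c = m + N m k)"
proof -
  let ?P = "pos_odd_rays m k"
  note Z_eq = Z_eq_sum_over_pos_odd_rays[OF assms(1,2)]
  have N_eq: "2 * card ?P = N m k" using card_pos_odd_rays assms by simp
  have finP: "finite ?P" by (simp add: pos_odd_rays_def)
  have posP: "0 < ray_coeff m k j" if "j \<in> ?P" for j
    using that by (simp add: pos_odd_rays_def)
  have "mono_on {0<..} (Z m k)"
  proof (rule mono_onI)
    fix c d :: real assume cd: "c \<in> {0<..}" "d \<in> {0<..}" "c \<le> d"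
    have "card (tri_roots m k (2 * c * ray_coeff m k j)) \<le>
        card (tri_roots m k (2 * d * ray_coeff m k j))" if "j \<in> ?P" for j
      using posP[OF that] cd assms by (intro card_tri_roots_mono) auto
    then show "Z m k c \<le> Z m k d" using cd by (simp add: Z_eq sum_mono)
  qed
  moreover have "m \<le> Z m k c \<and> Z m k c \<le> m + N m k" if "0 < c" for c
  proof -
    have "(\<Sum>j\<in>?P. card (tri_roots m k (2 * c * ray_coeff m k j))) \<le> card ?P * 2"
      using sum_bounded_above[of ?P "\<lambda>j. card (tri_roots m k (2 * c * ray_coeff m k j))" 2]
        tri_roots_finite_card_le_2[OF assms(1,2)] by simp
    then show ?thesis using that N_eq by (simp add: Z_eq)
  qed
  moreover have "Z m k (1 / 2) = m"
    using assms by (simp add: Z_eq tri_roots_empty ray_coeff_def)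
  moreover have "\<exists>c>0. Z m k c = m + N m k"
  proof -
    \<comment> \<open>Any \<open>c\<close> with \<open>c * ray_coeff m k j > 1\<close> on all these rays will do: then the coefficient in
      each trinomial equation exceeds 2, and \<open>r ^ m + 1 < b * r ^ k\<close> holds at \<open>r = 1\<close>.\<close>
    define c where "c = 1 + (\<Sum>j\<in>?P. 1 / ray_coeff m k j)"
    have nonneg: "0 \<le> (\<Sum>j\<in>?P. 1 / ray_coeff m k j)"
      using posP by (intro sum_nonneg) (simp add: less_imp_le)
    have "card (tri_roots m k (2 * c * ray_coeff m k j)) = 2" if j: "j \<in> ?P" for j
    proof -
      have "1 / ray_coeff m k j \<le> (\<Sum>j\<in>?P. 1 / ray_coeff m k j)"
        using posP finP j by (intro member_le_sum) (auto simp: less_imp_le)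
      then have "1 / ray_coeff m k j < c" by (simp add: c_def)
      then have "1 < c * ray_coeff m k j" using posP[OF j] by (simp add: field_simps)
      then show ?thesis using assms by (intro card_tri_roots_eq_2[of k m 1]) auto
    qed
    then have "Z m k c = m + N m k" using N_eq nonneg by (simp add: Z_eq c_def)
    then show ?thesis using nonneg by (intro exI[of _ c]) (auto simp: c_def)
  qed
  ultimately show ?thesis
    using finite_zeros[OF assms(1,2)] by (auto intro!: exI[of _ "1 / 2 :: real"])
qed

end
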